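(* There is a universal constant $0<C<1$ (one can choose e.g. $C=\frac1{50}$) such that the following holds. Let $\mathcal F$ be a finite or countable $L_1$-dense class of functions with some parameter $D\ge 1$ and exponent $L\ge 1$ on a measurable space $(X,\mathcal X)$ such that $\sup_{x\in X}|f(x)|\le 1$ for all $f\in\mathcal F$. Let $\xi_1,\dots,\xi_n$, $n\ge 2$, be a sequence of independent and identically distributed random variables with values in the space $(X,\mathcal X)$ whose common distribution $\mu$ satisfies $\int |f(x)|\,\mu(dx)\le\rho$ for all $f\in\mathcal F$ with a number $0<\rho\le n^{-200}$. Put $S_n(f)=S_n(f)(\xi_1,\dots,\xi_n)=\sum_{j=1}^n f(\xi_j)$ for all $f\in\mathcal F$. Then $$P\left(\sup_{f\in\mathcal F}|S_n(f)|\ge u\right)\le D\rho^{Cu}\qquad\text{for all } u>41L.$$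
   Context: Definition ($L_1$-dense class). Let $(X,\mathcal X)$ be a measurable space and $\mathcal F$ a class of $\mathcal X$-measurable real valued functions on $X$. The class $\mathcal F$ is called an $L_1$-dense class of functions with parameter $D$ and exponent $L$ if for all numbers $0<\varepsilon\le 1$ and all probability measures $\nu$ on $(X,\mathcal X)$ there exists a finite subset $\mathcal F_{\varepsilon,\nu}=\{f_1,\dots,f_m\}\subset\mathcal F$ with $m\le D\varepsilon^{-L}$ elements such that $\inf_{f_j\in\mathcal F_{\varepsilon,\nu}}\int|f-f_j|\,d\nu<\varepsilon$ for all $f\in\mathcal F$. (The set $\mathcal F_{\varepsilon,\nu}$ may depend on $\nu$, but the bound on its cardinality depends only on $\varepsilon$.) *)

theory Defs
  imports "HOL-Probability.Probability"
begin

text \<open>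
  The infimum and the distances are taken in \<^typ>\<open>ennreal\<close>: there the integral of a
  non-integrable difference is infinite rather than zero, and the infimum over the empty
  set is infinite.
\<close>

definition L1_dense_class :: "'x measure \<Rightarrow> ('x \<Rightarrow> real) set \<Rightarrow> real \<Rightarrow> real \<Rightarrow> bool" where
  "L1_dense_class X F D L \<longleftrightarrow>
     (\<forall>f\<in>F. f \<in> borel_measurable X) \<and>
     (\<forall>\<epsilon>::real. 0 < \<epsilon> \<and> \<epsilon> \<le> 1 \<longrightarrow>
       (\<forall>\<nu>::'x measure. prob_space \<nu> \<and> sets \<nu> = sets X \<longrightarrow>
         (\<exists>G. G \<subseteq> F \<and> finite G \<and> real (card G) \<le> D * \<epsilon> powr (- L) \<and>
           (\<forall>f\<in>F. (INF g\<in>G. \<integral>\<^sup>+ x. ennreal \<bar>f x - g x\<bar> \<partial>\<nu>) < ennreal \<epsilon>))))"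

definition sample_sum :: "(nat \<Rightarrow> 'a \<Rightarrow> 'x) \<Rightarrow> nat \<Rightarrow> ('x \<Rightarrow> real) \<Rightarrow> 'a \<Rightarrow> real" where
  "sample_sum \<xi> n f \<omega> = (\<Sum>j=1..n. f (\<xi> j \<omega>))"

end

theory Submission
  imports Defs
begin

text \<open>
  Place the sample in an array of n rows and K columns of i.i.d. points, with K about
  \<open>\<rho> powr (-1/2)\<close>. Since \<open>n * K * \<rho> \<le> 1/2\<close>, Markov's inequality shows that a function with a
  large sum over the sample has, with probability at least 1/2, a sum of absolute values of at
  most 1 over the rest of the array. Every choice of one point per row has the law of the
  sample, so it suffices to bound, for a fixed array, the proportion of the \<open>K ^ n\<close> choices
  for which some f has a large sum over the chosen points and a sum of at most 1 over the others.
  The empirical measure of the array reduces this to at most \<open>D * (n * K) powr L\<close> functions,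
  and for each of them a Chernoff bound over the choices gives a factor of about
  \<open>(exp 1 / K) powr u\<close>, which beats \<open>(n * K) powr L\<close> because \<open>u > 41 * L\<close>.
\<close>

section \<open>Counting bad selections in a fixed array, for a single function\<close>

lemma exp_mult_le_chord:
  fixes t a :: real
  assumes "0 \<le> a" "a \<le> 1"
  shows "exp (t * a) \<le> 1 + (exp t - 1) * a"
  using convex_onD[OF exp_convex, of a 0 t] assms by (simp add: algebra_simps)

text \<open>Exponential weights: a selection with chosen sum S in an array with total T gets the
  weight \<open>exp (t * S - s * T)\<close>. The weights factor over the rows, and convexity of exp
  bounds the contribution of each row by K, so they add up to at most \<open>K ^ card I\<close>. On
  the counted set every weight is at least \<open>exp ((t - 1) * w - r)\<close>. The term
  \<open>s * T\<close> absorbs row sums of any size, and \<open>t = ln K\<close> turns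
  \<open>exp (- (t - 1) * w)\<close> into the power of \<open>exp 1 / K\<close>.\<close>

lemma card_selection_le:
  fixes a :: "'i \<times> 'k \<Rightarrow> real"
  assumes fin: "finite I" "finite J" and J: "card J \<ge> 3"
    and a: "\<And>i k. i \<in> I \<Longrightarrow> k \<in> J \<Longrightarrow> 0 \<le> a (i, k) \<and> a (i, k) \<le> 1"
    and r: "0 \<le> r"
  shows "real (card {\<kappa> \<in> I \<rightarrow>\<^sub>E J. w \<le> (\<Sum>i\<in>I. a (i, \<kappa> i)) \<and>
             (\<Sum>p\<in>I \<times> J. a p) - (\<Sum>i\<in>I. a (i, \<kappa> i)) \<le> r})
         \<le> real (card J) ^ card I * (exp 1 / card J) powr w * exp r"
    (is "real (card ?B) \<le> _")
proof -
  define K where "K = real (card J)"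
  define t where "t = ln K"
  \<comment> \<open>This s makes the mean of \<open>exp (t * chosen entry - s * row sum)\<close> at most 1 in every row.\<close>
  define s where "s = (K - 1) / K"
  define A where "A i = (\<Sum>k\<in>J. a (i, k))" for i
  have K: "K \<ge> 3" using J by (simp add: K_def)
  \<comment> \<open>Since \<open>exp 1 <= 3\<close>, the factor \<open>t - 1\<close> is nonnegative,
    so that \<open>(t - 1) * w <= (t - 1) * S\<close> will follow from
    \<open>w <= S\<close>.\<close>
  have "exp 1 \<le> K" using K exp_le by linarith
  then have t: "t \<ge> 1" unfolding t_def using K ln_ge_iff[of K 1] by simp
  have s: "0 \<le> s" "s \<le> 1" using K by (auto simp: s_def)
  have et: "exp t = K" using K by (simp add: t_def)
  have total: "(\<Sum>p\<in>I \<times> J. a p) = (\<Sum>i\<in>I. A i)"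
    using fin by (simp add: A_def sum.cartesian_product)
  have row: "(\<Sum>k\<in>J. exp (t * a (i, k) - s * A i)) \<le> K" if "i \<in> I" for i
  proof -
    have "(\<Sum>k\<in>J. exp (t * a (i, k))) \<le> (\<Sum>k\<in>J. 1 + (K - 1) * a (i, k))"
      using exp_mult_le_chord[of _ t] a that by (intro sum_mono) (simp add: et)
    also have "\<dots> = K + (K - 1) * A i"
      by (simp add: sum.distrib A_def K_def sum_distrib_left)
    also have "\<dots> = K * (1 + s * A i)" using K by (simp add: s_def field_simps)
    also have "\<dots> \<le> K * exp (s * A i)" using K exp_ge_add_one_self by (intro mult_left_mono) auto
    finally have "(\<Sum>k\<in>J. exp (t * a (i, k))) * exp (- (s * A i)) \<le> K * exp (s * A i) * exp (- (s * A i))"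
      by (rule mult_right_mono) simp
    then show ?thesis
      by (simp add: exp_diff exp_minus field_simps sum_divide_distrib[symmetric])
  qed
  have "(\<Sum>\<kappa>\<in>I \<rightarrow>\<^sub>E J. exp (t * (\<Sum>i\<in>I. a (i, \<kappa> i)) - s * (\<Sum>i\<in>I. A i)))
      = (\<Sum>\<kappa>\<in>I \<rightarrow>\<^sub>E J. \<Prod>i\<in>I. exp (t * a (i, \<kappa> i) - s * A i))"
    using fin by (simp add: exp_sum[symmetric] sum_subtractf sum_distrib_left)
  also have "\<dots> = (\<Prod>i\<in>I. \<Sum>k\<in>J. exp (t * a (i, k) - s * A i))"
    using fin by (simp add: prod_sum_PiE)
  also have "\<dots> \<le> (\<Prod>i\<in>I. K)"
    using row by (intro prod_mono) (auto intro: sum_nonneg)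
  finally have mgf: "(\<Sum>\<kappa>\<in>I \<rightarrow>\<^sub>E J. exp (t * (\<Sum>i\<in>I. a (i, \<kappa> i)) - s * (\<Sum>i\<in>I. A i))) \<le> K ^ card I"
    by simp
  have finP: "finite (I \<rightarrow>\<^sub>E J)" using fin by (intro finite_PiE) auto
  have "real (card ?B) * exp ((t - 1) * w - r) = (\<Sum>\<kappa>\<in>?B. exp ((t - 1) * w - r))" by simp
  also have "\<dots> \<le> (\<Sum>\<kappa>\<in>?B. exp (t * (\<Sum>i\<in>I. a (i, \<kappa> i)) - s * (\<Sum>i\<in>I. A i)))"
  proof (intro sum_mono)
    fix \<kappa> assume \<kappa>: "\<kappa> \<in> ?B"
    define S where "S = (\<Sum>i\<in>I. a (i, \<kappa> i))"
    have S: "w \<le> S" "(\<Sum>i\<in>I. A i) - S \<le> r" using \<kappa> total by (auto simp: S_def)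
    have "0 \<le> S" unfolding S_def using \<kappa> a by (intro sum_nonneg) auto
    \<comment> \<open>The unchosen entries sum to at most r, hence s times the total is at most
      \<open>s * S + s * r\<close>. As S and r are nonnegative and \<open>s <= 1\<close>, this is in
      turn at most \<open>S + r\<close>.\<close>
    have "(t - 1) * w - r \<le> (t - 1) * S - r" using t S by (simp add: mult_left_mono)
    also have "\<dots> \<le> (t - s) * S - s * r"
      using s \<open>0 \<le> S\<close> r mult_right_mono[of s 1 S] mult_right_mono[of s 1 r] by (simp add: algebra_simps)
    also have "\<dots> \<le> t * S - s * (\<Sum>i\<in>I. A i)"
      using mult_left_mono[OF S(2) s(1)] by (simp add: algebra_simps)
    finally show "exp ((t - 1) * w - r) \<le> exp (t * (\<Sum>i\<in>I. a (i, \<kappa> i)) - s * (\<Sum>i\<in>I. A i))"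
      by (simp add: S_def)
  qed
  also have "\<dots> \<le> (\<Sum>\<kappa>\<in>I \<rightarrow>\<^sub>E J. exp (t * (\<Sum>i\<in>I. a (i, \<kappa> i)) - s * (\<Sum>i\<in>I. A i)))"
    using finP by (intro sum_mono2) auto
  also note mgf
  finally have "real (card ?B) * exp ((t - 1) * w - r) * exp (r - (t - 1) * w)
      \<le> K ^ card I * exp (r - (t - 1) * w)"
    by (rule mult_right_mono) simp
  moreover have "exp ((t - 1) * w - r) * exp (r - (t - 1) * w) = 1"
    by (simp flip: exp_add)
  moreover have "exp (r - (t - 1) * w) = (exp 1 / K) powr w * exp r"
    using K by (simp add: powr_def ln_div t_def algebra_simps flip: exp_add)
  ultimately show ?thesis by (simp add: K_def mult.assoc)
qed

section \<open>Reduction of the class to a finite net on the array\<close>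

text \<open>Density is applied to the empirical measure of the points with
  \<open>\<epsilon> = 1 / card A\<close>: an average distance below \<open>1 / card A\<close> is a
  total distance below 1. The points are indexed by A and may coincide, since the measure is the
  image of the uniform one on A.\<close>

lemma L1_dense_class_empirical_net:
  assumes dense: "L1_dense_class X F D L" and A: "finite A" "A \<noteq> {}" and x: "x \<in> A \<rightarrow> space X"
  obtains G where "G \<subseteq> F" "finite G" "real (card G) \<le> D * real (card A) powr L"
    "\<And>f. f \<in> F \<Longrightarrow> \<exists>g\<in>G. (\<Sum>a\<in>A. \<bar>f (x a) - g (x a)\<bar>) < 1"
proof -
  define \<epsilon> where "\<epsilon> = 1 / real (card A)"
  define \<nu> where "\<nu> = distr (uniform_count_measure A) X x"
  have cA: "card A \<ge> 1" using A by (simp add: Suc_leI card_gt_0_iff)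
  have \<epsilon>: "0 < \<epsilon>" "\<epsilon> \<le> 1" using cA by (auto simp: \<epsilon>_def)
  have meas: "x \<in> measurable (uniform_count_measure A) X"
    using x by (auto simp: measurable_def space_uniform_count_measure sets_uniform_count_measure)
  have \<nu>: "prob_space \<nu> \<and> sets \<nu> = sets X"
    using prob_space.prob_space_distr[OF prob_space_uniform_count_measure[OF A] meas]
    by (simp add: \<nu>_def)
  have fmeas: "f \<in> borel_measurable X" if "f \<in> F" for f
    using dense that by (simp add: L1_dense_class_def)
  obtain G where G: "G \<subseteq> F" "finite G" "real (card G) \<le> D * \<epsilon> powr (- L)"
      "\<And>f. f \<in> F \<Longrightarrow> (INF g\<in>G. \<integral>\<^sup>+ x. ennreal \<bar>f x - g x\<bar> \<partial>\<nu>) < ennreal \<epsilon>"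
    using dense[unfolded L1_dense_class_def, THEN conjunct2, rule_format, OF conjI[OF \<epsilon>] \<nu>] by auto
  have "\<epsilon> powr (- L) = real (card A) powr L"
    using cA by (simp add: \<epsilon>_def powr_minus_divide powr_divide)
  moreover have "\<exists>g\<in>G. (\<Sum>a\<in>A. \<bar>f (x a) - g (x a)\<bar>) < 1" if f: "f \<in> F" for f
  proof -
    \<comment> \<open>The strict bound on the infimum is passed on to some member of G, which also
      excludes an empty G here.\<close>
    obtain g where g: "g \<in> G" "(\<integral>\<^sup>+ x. ennreal \<bar>f x - g x\<bar> \<partial>\<nu>) < ennreal \<epsilon>"
      using G(4)[OF f] by (auto simp: INF_less_iff)
    have m: "f \<in> borel_measurable X" "g \<in> borel_measurable X" using f g G(1) fmeas by auto
    have "(\<integral>\<^sup>+ x. ennreal \<bar>f x - g x\<bar> \<partial>\<nu>) = (\<Sum>a\<in>A. ennreal (1 / card A) * ennreal \<bar>f (x a) - g (x a)\<bar>)"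
      unfolding \<nu>_def using m meas A
      by (simp add: nn_integral_distr uniform_count_measure_def nn_integral_point_measure_finite)
    also have "\<dots> = ennreal (\<epsilon> * (\<Sum>a\<in>A. \<bar>f (x a) - g (x a)\<bar>))"
      using \<epsilon> by (simp add: sum_distrib_left \<epsilon>_def flip: ennreal_mult' sum_ennreal)
    finally have "\<epsilon> * (\<Sum>a\<in>A. \<bar>f (x a) - g (x a)\<bar>) < \<epsilon> * 1"
      using g(2) \<epsilon> by (simp add: ennreal_less_iff sum_nonneg)
    then show ?thesis using g(1) \<epsilon> by (auto simp del: mult_1_right)
  qed
  ultimately show ?thesis using that[of G] G by simp
qed


text \<open>Union bound over the net. Replacing f by a net function g at total distance below 1
  changes the chosen sum and the unchosen sum by less than 1 each; therefore the thresholds v and 1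
  become \<open>v - 1\<close> and 2, and 2 is the exponent in \<open>exp 2\<close>.\<close>

lemma card_selection_class_le:
  fixes F :: "('x \<Rightarrow> real) set"
  assumes dense: "L1_dense_class X F D L"
    and bounded: "\<And>f x. f \<in> F \<Longrightarrow> x \<in> space X \<Longrightarrow> \<bar>f x\<bar> \<le> 1"
    and fin: "finite I" "finite J" and I: "I \<noteq> {}" and J: "card J \<ge> 3"
    and x: "x \<in> I \<times> J \<rightarrow> space X"
  shows "real (card {\<kappa> \<in> I \<rightarrow>\<^sub>E J. \<exists>f\<in>F. v \<le> (\<Sum>i\<in>I. \<bar>f (x (i, \<kappa> i))\<bar>) \<and>
             (\<Sum>p\<in>I \<times> J. \<bar>f (x p)\<bar>) - (\<Sum>i\<in>I. \<bar>f (x (i, \<kappa> i))\<bar>) \<le> 1})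
         \<le> D * (card I * card J) powr L * (real (card J) ^ card I * (exp 1 / card J) powr (v - 1) * exp 2)"
    (is "real (card ?B) \<le> _ * ?c")
proof -
  define A where "A g = {\<kappa> \<in> I \<rightarrow>\<^sub>E J. v - 1 \<le> (\<Sum>i\<in>I. \<bar>g (x (i, \<kappa> i))\<bar>) \<and>
      (\<Sum>p\<in>I \<times> J. \<bar>g (x p)\<bar>) - (\<Sum>i\<in>I. \<bar>g (x (i, \<kappa> i))\<bar>) \<le> 2}" for g :: "'x \<Rightarrow> real"
  have IJ: "finite (I \<times> J)" "I \<times> J \<noteq> {}" using I J fin by auto
  obtain G where G: "G \<subseteq> F" "finite G" "real (card G) \<le> D * real (card (I \<times> J)) powr L"
    "\<And>f. f \<in> F \<Longrightarrow> \<exists>g\<in>G. (\<Sum>p\<in>I \<times> J. \<bar>f (x p) - g (x p)\<bar>) < 1"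
    by (rule L1_dense_class_empirical_net[OF dense IJ x]) blast
  have finA: "finite (A g)" for g unfolding A_def using fin by (intro finite_subset[OF _ finite_PiE[of I "\<lambda>_. J"]]) auto
  have "?B \<subseteq> (\<Union>g\<in>G. A g)"
  proof
    fix \<kappa> assume \<kappa>: "\<kappa> \<in> ?B"
    \<comment> \<open>The chosen positions as a set of pairs: sums over chosen and unchosen entries
      become sums over R and its complement in the array.\<close>
    define R where "R = (\<lambda>i. (i, \<kappa> i)) ` I"
    have R: "R \<subseteq> I \<times> J" using \<kappa> by (auto simp: R_def)
    have sel: "(\<Sum>i\<in>I. \<bar>f (x (i, \<kappa> i))\<bar>) = (\<Sum>p\<in>R. \<bar>f (x p)\<bar>)" for f :: "'x \<Rightarrow> real"
      unfolding R_def by (subst sum.reindex) (auto simp: inj_on_def)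
    have compl: "(\<Sum>p\<in>I \<times> J. \<bar>f (x p)\<bar>) - (\<Sum>p\<in>R. \<bar>f (x p)\<bar>) = (\<Sum>p\<in>I \<times> J - R. \<bar>f (x p)\<bar>)" for f :: "'x \<Rightarrow> real"
      using R fin by (simp add: sum_diff)
    obtain f where f: "f \<in> F" "v \<le> (\<Sum>p\<in>R. \<bar>f (x p)\<bar>)" "(\<Sum>p\<in>I \<times> J - R. \<bar>f (x p)\<bar>) \<le> 1"
      using \<kappa> by (auto simp: sel compl)
    obtain g where g: "g \<in> G" "(\<Sum>p\<in>I \<times> J. \<bar>f (x p) - g (x p)\<bar>) < 1" using G(4)[OF f(1)] by auto
    \<comment> \<open>The distance on the whole array dominates the distance on every part of it, so
      the same g serves both R and its complement.\<close>
    have part: "(\<Sum>p\<in>Q. \<bar>f (x p) - g (x p)\<bar>) < 1" if "Q \<subseteq> I \<times> J" for Q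
      using sum_mono2[of "I \<times> J" Q "\<lambda>p. \<bar>f (x p) - g (x p)\<bar>"] that fin g(2) by force
    have "(\<Sum>p\<in>R. \<bar>f (x p)\<bar>) - (\<Sum>p\<in>R. \<bar>g (x p)\<bar>) \<le> (\<Sum>p\<in>R. \<bar>f (x p) - g (x p)\<bar>)"
      unfolding sum_subtractf[symmetric] by (intro sum_mono) auto
    moreover have "(\<Sum>p\<in>I \<times> J - R. \<bar>g (x p)\<bar>) - (\<Sum>p\<in>I \<times> J - R. \<bar>f (x p)\<bar>)
        \<le> (\<Sum>p\<in>I \<times> J - R. \<bar>f (x p) - g (x p)\<bar>)"
      unfolding sum_subtractf[symmetric] by (intro sum_mono) auto
    ultimately have "\<kappa> \<in> A g"
      using f part[OF R] part[of "I \<times> J - R"] \<kappa>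
      unfolding A_def by (auto simp: sel compl)
    then show "\<kappa> \<in> (\<Union>g\<in>G. A g)" using g(1) by auto
  qed
  then have "card ?B \<le> card (\<Union>g\<in>G. A g)" using finA G(2) by (intro card_mono) auto
  also have "\<dots> \<le> (\<Sum>g\<in>G. card (A g))" using G(2) by (rule card_UN_le)
  finally have "real (card ?B) \<le> (\<Sum>g\<in>G. real (card (A g)))" by (simp flip: of_nat_sum)
  also have "\<dots> \<le> (\<Sum>g\<in>G. ?c)"
    unfolding A_def using x G(1) bounded fin J
    by (intro sum_mono card_selection_le) (auto simp: Pi_iff subset_iff)
  also have "\<dots> \<le> D * (card I * card J) powr L * ?c"
    using G(3) by (simp add: card_cartesian_product mult_right_mono)
  finally show ?thesis .
qed

section \<open>Decoupling the sample from the rest of the array\<close>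

text \<open>Countability of F makes the existential a countable union. Taking \<open>R = {}\<close>
  with \<open>c = 1\<close>, or \<open>Q = {}\<close> with \<open>v = 0\<close>, makes one of the
  two conditions void, so this covers the one-sided events below as well.\<close>

lemma measurable_class_sum_pred:
  fixes F :: "('x \<Rightarrow> real) set"
  assumes "countable F" "\<And>f. f \<in> F \<Longrightarrow> f \<in> borel_measurable \<mu>" "Q \<subseteq> P" "R \<subseteq> P"
  shows "{x \<in> space (\<Pi>\<^sub>M i\<in>P. \<mu>). \<exists>f\<in>F. v \<le> (\<Sum>i\<in>Q. \<bar>f (x i)\<bar>) \<and> (\<Sum>i\<in>R. \<bar>f (x i)\<bar>) \<le> c}
    \<in> sets (\<Pi>\<^sub>M i\<in>P. \<mu>)"
proof -
  have [measurable]: "(\<lambda>x. f (x i)) \<in> borel_measurable (\<Pi>\<^sub>M i\<in>P. \<mu>)" if "f \<in> F" "i \<in> P" for f i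
    using measurable_compose[OF measurable_component_singleton[OF that(2)] assms(2)[OF that(1)]] .
  have "(\<lambda>x. \<Sum>i\<in>S. \<bar>f (x i)\<bar>) \<in> borel_measurable (\<Pi>\<^sub>M i\<in>P. \<mu>)" if "f \<in> F" "S \<subseteq> P" for f S
    using that by (intro borel_measurable_sum borel_measurable_abs) auto
  then show ?thesis
    using assms by (intro sets.sets_Collect_countable_Ex' sets.sets_Collect_conj borel_measurable_le) auto
qed

text \<open>Markov's inequality: every coordinate has law \<open>\<mu>\<close>, so by linearity the
  sum has mean at most \<open>card Q * \<rho>\<close>.\<close>

lemma prob_sum_le_one_ge:
  fixes f :: "'x \<Rightarrow> real"
  assumes \<mu>: "prob_space \<mu>" and f: "f \<in> borel_measurable \<mu>" and fin: "finite Q"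
    and mean: "(\<integral>\<^sup>+x. ennreal \<bar>f x\<bar> \<partial>\<mu>) \<le> ennreal \<rho>" and \<rho>: "0 \<le> \<rho>"
  shows "1 - real (card Q) * \<rho> \<le> measure (\<Pi>\<^sub>M i\<in>Q. \<mu>) {y \<in> space (\<Pi>\<^sub>M i\<in>Q. \<mu>). (\<Sum>i\<in>Q. \<bar>f (y i)\<bar>) \<le> 1}"
proof -
  let ?\<Omega> = "\<Pi>\<^sub>M i\<in>Q. \<mu>"
  interpret \<mu>: prob_space \<mu> by fact
  interpret Q: prob_space ?\<Omega> by (intro prob_space_PiM \<mu>)
  have [measurable]: "(\<lambda>y. f (y i)) \<in> borel_measurable ?\<Omega>" if "i \<in> Q" for i
    using measurable_compose[OF measurable_component_singleton[OF that] f] .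
  have meas: "(\<lambda>y. \<Sum>i\<in>Q. \<bar>f (y i)\<bar>) \<in> borel_measurable ?\<Omega>" by measurable
  have comp: "(\<integral>\<^sup>+y. ennreal \<bar>f (y i)\<bar> \<partial>?\<Omega>) = (\<integral>\<^sup>+x. ennreal \<bar>f x\<bar> \<partial>\<mu>)" if i: "i \<in> Q" for i
  proof -
    have "(\<integral>\<^sup>+x. ennreal \<bar>f x\<bar> \<partial>\<mu>) = (\<integral>\<^sup>+x. ennreal \<bar>f x\<bar> \<partial>distr ?\<Omega> \<mu> (\<lambda>y. y i))"
      using distr_PiM_component[of Q "\<lambda>_. \<mu>" i] i \<mu> by simp
    also have "\<dots> = (\<integral>\<^sup>+y. ennreal \<bar>f (y i)\<bar> \<partial>?\<Omega>)"
      using i f by (subst nn_integral_distr) auto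
    finally show ?thesis by simp
  qed
  have "emeasure ?\<Omega> {y \<in> space ?\<Omega>. 1 \<le> 1 * ennreal (\<Sum>i\<in>Q. \<bar>f (y i)\<bar>)}
      \<le> 1 * (\<integral>\<^sup>+y. ennreal (\<Sum>i\<in>Q. \<bar>f (y i)\<bar>) * indicator (space ?\<Omega>) y \<partial>?\<Omega>)"
    using meas by (intro nn_integral_Markov_inequality) auto
  also have "\<dots> = (\<integral>\<^sup>+y. (\<Sum>i\<in>Q. ennreal \<bar>f (y i)\<bar>) \<partial>?\<Omega>)"
    by (auto intro!: nn_integral_cong simp: sum_ennreal)
  also have "\<dots> = (\<Sum>i\<in>Q. \<integral>\<^sup>+y. ennreal \<bar>f (y i)\<bar> \<partial>?\<Omega>)"
    by (rule nn_integral_sum) auto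
  also have "\<dots> \<le> (\<Sum>i\<in>Q. ennreal \<rho>)" using mean comp by (intro sum_mono) simp
  also have "\<dots> = ennreal (real (card Q) * \<rho>)"
    using \<rho> by (simp add: ennreal_of_nat_eq_real_of_nat flip: ennreal_mult)
  finally have big: "Q.prob {y \<in> space ?\<Omega>. 1 \<le> (\<Sum>i\<in>Q. \<bar>f (y i)\<bar>)} \<le> real (card Q) * \<rho>"
    using \<rho> by (simp add: Q.emeasure_eq_measure)
  have "Q.prob {y \<in> space ?\<Omega>. 1 < (\<Sum>i\<in>Q. \<bar>f (y i)\<bar>)} \<le> Q.prob {y \<in> space ?\<Omega>. 1 \<le> (\<Sum>i\<in>Q. \<bar>f (y i)\<bar>)}"
    using meas by (intro Q.finite_measure_mono) auto
  moreover have "Q.prob {y \<in> space ?\<Omega>. \<not> (\<Sum>i\<in>Q. \<bar>f (y i)\<bar>) \<le> 1} = 1 - Q.prob {y \<in> space ?\<Omega>. (\<Sum>i\<in>Q. \<bar>f (y i)\<bar>) \<le> 1}"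
    using meas by (intro Q.prob_neg) measurable
  ultimately show ?thesis using big by (simp add: not_le)
qed

text \<open>Fubini: if some f has a large sum over H, then f can be picked from the coordinates in H
  alone. The coordinates in \<open>P - H\<close> are independent of these, so with probability at
  least 1/2 the sum of this f over them is at most 1.\<close>

lemma symmetrization:
  fixes F :: "('x \<Rightarrow> real) set"
  assumes \<mu>: "prob_space \<mu>" and F: "countable F" "\<And>f. f \<in> F \<Longrightarrow> f \<in> borel_measurable \<mu>"
    and mean: "\<And>f. f \<in> F \<Longrightarrow> (\<integral>\<^sup>+x. ennreal \<bar>f x\<bar> \<partial>\<mu>) \<le> ennreal \<rho>"
    and \<rho>: "real (card P) * \<rho> \<le> 1 / 2" "0 \<le> \<rho>" and P: "finite P" "H \<subseteq> P"
  shows "measure (\<Pi>\<^sub>M i\<in>H. \<mu>) {x \<in> space (\<Pi>\<^sub>M i\<in>H. \<mu>). \<exists>f\<in>F. v \<le> (\<Sum>i\<in>H. \<bar>f (x i)\<bar>)}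
    \<le> 2 * measure (\<Pi>\<^sub>M i\<in>P. \<mu>) {x \<in> space (\<Pi>\<^sub>M i\<in>P. \<mu>).
        \<exists>f\<in>F. v \<le> (\<Sum>i\<in>H. \<bar>f (x i)\<bar>) \<and> (\<Sum>i\<in>P - H. \<bar>f (x i)\<bar>) \<le> 1}"
    (is "measure ?H ?E \<le> 2 * measure ?P ?A")
proof -
  let ?Q = "\<Pi>\<^sub>M i\<in>P - H. \<mu>"
  interpret \<mu>: prob_space \<mu> by fact
  interpret product_sigma_finite "\<lambda>_. \<mu>" by standard
  interpret H: prob_space ?H by (intro prob_space_PiM \<mu>)
  interpret P: prob_space ?P by (intro prob_space_PiM \<mu>)
  have finH: "finite H" using P finite_subset by blast
  have PH: "H \<union> (P - H) = P" using P by auto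
  have A: "?A \<in> sets ?P" using P by (intro measurable_class_sum_pred F) auto
  have E: "?E \<in> sets ?H" using measurable_class_sum_pred[OF F, of H H "{}" v 1] by simp
  interpret Q: prob_space ?Q by (intro prob_space_PiM \<mu>)
  \<comment> \<open>Here x is frozen and only the coordinates in \<open>P - H\<close> are random;
    the witness f is fixed before y is drawn, so the Markov bound for a single function
    suffices.\<close>
  have fiber: "ennreal (1/2) * indicator ?E x \<le> (\<integral>\<^sup>+y. indicator ?A (merge H (P - H) (x, y)) \<partial>?Q)"
    if x: "x \<in> space ?H" for x
  proof (cases "x \<in> ?E")
    case True
    then obtain f where f: "f \<in> F" "v \<le> (\<Sum>i\<in>H. \<bar>f (x i)\<bar>)" by auto
    define B where "B = {y \<in> space ?Q. (\<Sum>i\<in>P - H. \<bar>f (y i)\<bar>) \<le> 1}"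
    have "card (P - H) \<le> card P" using P by (intro card_mono) auto
    then have "real (card (P - H)) * \<rho> \<le> 1 / 2"
      using \<rho> mult_right_mono[of "real (card (P - H))" "real (card P)" \<rho>] by simp
    moreover have "1 - real (card (P - H)) * \<rho> \<le> Q.prob B"
      unfolding B_def using P f(1) \<rho> by (intro prob_sum_le_one_ge[OF \<mu>] F mean) auto
    ultimately have "ennreal (1/2) \<le> emeasure ?Q B"
      unfolding Q.emeasure_eq_measure by (intro ennreal_leI) simp
    also have "\<dots> = (\<integral>\<^sup>+y. indicator B y \<partial>?Q)"
      using measurable_class_sum_pred[of "{f}" \<mu> "{}" "P - H" "P - H" 0 1] F(2)[OF f(1)]
      by (simp add: B_def)
    also have "\<dots> \<le> (\<integral>\<^sup>+y. indicator ?A (merge H (P - H) (x, y)) \<partial>?Q)"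
    proof (intro nn_integral_mono)
      fix y assume y: "y \<in> space ?Q"
      have "merge H (P - H) (x, y) \<in> ?A" if "y \<in> B"
      proof -
        have "merge H (P - H) (x, y) \<in> space ?P"
          using x y P by (auto simp: space_PiM merge_def PiE_iff extensional_def)
        moreover have "(\<Sum>i\<in>H. \<bar>f (merge H (P - H) (x, y) i)\<bar>) = (\<Sum>i\<in>H. \<bar>f (x i)\<bar>)"
          by (intro sum.cong) (auto simp: merge_def)
        moreover have "(\<Sum>i\<in>P - H. \<bar>f (merge H (P - H) (x, y) i)\<bar>) = (\<Sum>i\<in>P - H. \<bar>f (y i)\<bar>)"
          by (intro sum.cong) (auto simp: merge_def)
        ultimately show ?thesis using f that by (auto simp: B_def)
      qed
      then show "indicator B y \<le> (indicator ?A (merge H (P - H) (x, y)) :: ennreal)"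
        by (auto split: split_indicator)
    qed
    finally show ?thesis using True by (simp only: indicator_simps mult_1_right)
  qed auto
  have "ennreal (1/2) * emeasure ?H ?E = (\<integral>\<^sup>+x. ennreal (1/2) * indicator ?E x \<partial>?H)"
    using E by (simp add: nn_integral_cmult_indicator)
  \<comment> \<open>Integrating the fiber bound over x; the iterated integral is then the integral
    over the product indexed by the disjoint union P of H and \<open>P - H\<close>.\<close>
  also have "\<dots> \<le> (\<integral>\<^sup>+x. (\<integral>\<^sup>+y. indicator ?A (merge H (P - H) (x, y)) \<partial>?Q) \<partial>?H)"
    using fiber by (intro nn_integral_mono)
  also have "\<dots> = (\<integral>\<^sup>+x. indicator ?A x \<partial>?P)"
    using A P finH
    by (intro product_nn_integral_fold[of H "P - H" "indicator ?A", unfolded PH, symmetric]) auto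
  also have "\<dots> = emeasure ?P ?A" using A by simp
  finally have "ennreal (1/2 * H.prob ?E) \<le> ennreal (P.prob ?A)"
    by (simp only: H.emeasure_eq_measure P.emeasure_eq_measure ennreal_mult' measure_nonneg)
  then show ?thesis by (subst (asm) ennreal_le_iff) auto
qed

section \<open>Averaging over all selections\<close>

text \<open>Used with \<open>e i = (i, \<kappa> i)\<close>: the points picked by any fixed selection
  have the law of the sample.\<close>

lemma measure_PiM_reindex_sum:
  fixes F :: "('x \<Rightarrow> real) set"
  assumes \<mu>: "prob_space \<mu>" and F: "countable F" "\<And>f. f \<in> F \<Longrightarrow> f \<in> borel_measurable \<mu>"
    and e: "inj_on e I"
  shows "measure (\<Pi>\<^sub>M i\<in>I. \<mu>) {x \<in> space (\<Pi>\<^sub>M i\<in>I. \<mu>). \<exists>f\<in>F. v \<le> (\<Sum>i\<in>I. \<bar>f (x i)\<bar>)}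
    = measure (\<Pi>\<^sub>M i\<in>e ` I. \<mu>) {x \<in> space (\<Pi>\<^sub>M i\<in>e ` I. \<mu>). \<exists>f\<in>F. v \<le> (\<Sum>i\<in>e ` I. \<bar>f (x i)\<bar>)}"
    (is "measure ?I ?E = measure ?R ?E'")
proof -
  let ?t = "\<lambda>\<omega>. \<lambda>i\<in>I. \<omega> (e i)"
  have t: "?t \<in> measurable ?R ?I"
    by (intro measurable_restrict measurable_component_singleton) auto
  have E: "?E \<in> sets ?I" using measurable_class_sum_pred[OF F, of I I "{}" v 1] by simp
  have "measure ?I ?E = measure (distr ?R ?I ?t) ?E"
    using distr_PiM_reindex[of "e ` I" "\<lambda>_. \<mu>" e I] \<mu> e by simp
  also have "\<dots> = measure ?R (?t -` ?E \<inter> space ?R)"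
    using t E by (rule measure_distr)
  also have "?t -` ?E \<inter> space ?R = ?E'"
    using measurable_space[OF t] e by (auto simp: sum.reindex)
  finally show ?thesis .
qed

text \<open>For each of the \<open>K ^ card I\<close> selections, symmetrization bounds the tail by
  twice the probability that this selection is bad. Summing over the selections gives twice the
  expected number of bad ones, and that number is bounded for every array by the counting
  result.\<close>

lemma iid_class_sum_tail:
  fixes F :: "('x \<Rightarrow> real) set"
  assumes dense: "L1_dense_class X F D L" and F: "countable F"
    and bounded: "\<And>f x. f \<in> F \<Longrightarrow> x \<in> space X \<Longrightarrow> \<bar>f x\<bar> \<le> 1"
    and \<mu>: "prob_space \<mu>" "sets \<mu> = sets X"
    and mean: "\<And>f. f \<in> F \<Longrightarrow> (\<integral>\<^sup>+x. ennreal \<bar>f x\<bar> \<partial>\<mu>) \<le> ennreal \<rho>"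
    and I: "finite (I :: 'i set)" "I \<noteq> {}" and K: "K \<ge> 3" and \<rho>: "real (card I) * real K * \<rho> \<le> 1 / 2" "0 \<le> \<rho>"
  shows "measure (\<Pi>\<^sub>M i\<in>I. \<mu>) {x \<in> space (\<Pi>\<^sub>M i\<in>I. \<mu>). \<exists>f\<in>F. v \<le> (\<Sum>i\<in>I. \<bar>f (x i)\<bar>)}
    \<le> 2 * (D * (real (card I) * real K) powr L * ((exp 1 / K) powr (v - 1) * exp 2))"
    (is "measure ?I ?E \<le> 2 * ?c")
proof -
  let ?J = "{..<K}"
  let ?P = "I \<times> ?J"
  let ?\<Omega> = "\<Pi>\<^sub>M p\<in>?P. \<mu>"
  define R where "R \<kappa> = (\<lambda>i. (i, \<kappa> i)) ` I" for \<kappa> :: "'i \<Rightarrow> nat"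
  define A where "A \<kappa> = {x \<in> space ?\<Omega>. \<exists>f\<in>F. v \<le> (\<Sum>p\<in>R \<kappa>. \<bar>f (x p)\<bar>) \<and> (\<Sum>p\<in>?P - R \<kappa>. \<bar>f (x p)\<bar>) \<le> 1}" for \<kappa>
  interpret \<Omega>: prob_space ?\<Omega> by (intro prob_space_PiM \<mu>)
  have meas: "f \<in> borel_measurable \<mu>" if "f \<in> F" for f
    using dense that \<mu>(2) by (simp add: L1_dense_class_def cong: measurable_cong_sets)
  have R: "R \<kappa> \<subseteq> ?P" if "\<kappa> \<in> I \<rightarrow>\<^sub>E ?J" for \<kappa> using that by (auto simp: R_def)
  have finP: "finite ?P" using I by simp
  have A: "A \<kappa> \<in> \<Omega>.events" if "\<kappa> \<in> I \<rightarrow>\<^sub>E ?J" for \<kappa>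
    unfolding A_def using R[OF that] by (intro measurable_class_sum_pred F meas) auto
  have each: "measure ?I ?E \<le> 2 * \<Omega>.prob (A \<kappa>)" if "\<kappa> \<in> I \<rightarrow>\<^sub>E ?J" for \<kappa>
  proof -
    have "measure ?I ?E = measure (\<Pi>\<^sub>M i\<in>R \<kappa>. \<mu>) {x \<in> space (\<Pi>\<^sub>M i\<in>R \<kappa>. \<mu>). \<exists>f\<in>F. v \<le> (\<Sum>i\<in>R \<kappa>. \<bar>f (x i)\<bar>)}"
      unfolding R_def by (intro measure_PiM_reindex_sum \<mu> F meas) (auto simp: inj_on_def)
    also have "\<dots> \<le> 2 * \<Omega>.prob (A \<kappa>)"
      unfolding A_def using \<rho> finP R[OF that]
      by (intro symmetrization[where \<rho>=\<rho>] \<mu> F meas mean) (auto simp: card_cartesian_product)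
    finally show ?thesis .
  qed
  \<comment> \<open>The array x is fixed here, so this is pure counting and holds at every point of
    the space.\<close>
  have count: "(\<Sum>\<kappa>\<in>I \<rightarrow>\<^sub>E ?J. indicat_real (A \<kappa>) x) \<le> real K ^ card I * ?c" if x: "x \<in> space ?\<Omega>" for x
  proof -
    have sel: "(\<Sum>p\<in>R \<kappa>. \<bar>f (x p)\<bar>) = (\<Sum>i\<in>I. \<bar>f (x (i, \<kappa> i))\<bar>)" for f :: "'x \<Rightarrow> real" and \<kappa>
      unfolding R_def by (subst sum.reindex) (auto simp: inj_on_def)
    have compl: "(\<Sum>p\<in>?P - R \<kappa>. \<bar>f (x p)\<bar>) = (\<Sum>p\<in>?P. \<bar>f (x p)\<bar>) - (\<Sum>i\<in>I. \<bar>f (x (i, \<kappa> i))\<bar>)"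
      if "\<kappa> \<in> I \<rightarrow>\<^sub>E ?J" for f :: "'x \<Rightarrow> real" and \<kappa>
      unfolding sel[symmetric] using R[OF that] finP by (simp add: sum_diff)
    have xs: "x \<in> ?P \<rightarrow> space X"
      using x sets_eq_imp_space_eq[OF \<mu>(2)] by (auto simp: space_PiM)
    have "(\<Sum>\<kappa>\<in>I \<rightarrow>\<^sub>E ?J. indicat_real (A \<kappa>) x) = real (card {\<kappa> \<in> I \<rightarrow>\<^sub>E ?J. x \<in> A \<kappa>})"
      using I by (simp add: indicator_def sum.If_cases finite_PiE Int_def)
    also have "{\<kappa> \<in> I \<rightarrow>\<^sub>E ?J. x \<in> A \<kappa>} = {\<kappa> \<in> I \<rightarrow>\<^sub>E ?J. \<exists>f\<in>F. v \<le> (\<Sum>i\<in>I. \<bar>f (x (i, \<kappa> i))\<bar>) \<and>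
             (\<Sum>p\<in>?P. \<bar>f (x p)\<bar>) - (\<Sum>i\<in>I. \<bar>f (x (i, \<kappa> i))\<bar>) \<le> 1}"
      using x by (intro Collect_cong conj_cong refl) (simp add: A_def sel compl)
    also have "real (card \<dots>) \<le> real K ^ card I * ?c"
      using card_selection_class_le[of X F D L I ?J x v] dense bounded I xs K by (simp add: mult_ac)
    finally show ?thesis .
  qed
  have "real K ^ card I * measure ?I ?E = (\<Sum>\<kappa>\<in>I \<rightarrow>\<^sub>E ?J. measure ?I ?E)"
    using I by (simp add: card_PiE)
  also have "\<dots> \<le> (\<Sum>\<kappa>\<in>I \<rightarrow>\<^sub>E ?J. 2 * \<Omega>.prob (A \<kappa>))"
    using each by (rule sum_mono)
  also have "\<dots> = 2 * (\<integral>x. (\<Sum>\<kappa>\<in>I \<rightarrow>\<^sub>E ?J. indicat_real (A \<kappa>) x) \<partial>?\<Omega>)"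
    using A by (subst Bochner_Integration.integral_sum) (auto simp: sum_distrib_left \<Omega>.emeasure_eq_measure)
  also have "\<dots> \<le> 2 * (\<integral>x. real K ^ card I * ?c \<partial>?\<Omega>)"
    using A count by (intro mult_left_mono integral_mono Bochner_Integration.integrable_sum)
      (auto simp: \<Omega>.emeasure_eq_measure)
  finally have "real K ^ card I * measure ?I ?E \<le> real K ^ card I * (2 * ?c)"
    by (simp add: \<Omega>.prob_space mult_ac)
  then show ?thesis using K by (simp add: mult_le_cancel_left_pos)
qed

section \<open>Choice of the array width and numerical estimates\<close>

text \<open>With \<open>r = - ln \<rho>\<close>, the left side collects the logarithms of the
  factors of the tail bound: 1 for the factor 2, then \<open>(n * K) powr L\<close>, the Chernoff
  factor and \<open>exp 2\<close>. The term \<open>- r * u / 2\<close> dominates.\<close>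

lemma tail_exponent_estimate:
  fixes L u r :: real
  assumes "L \<ge> 1" "u > 41 * L" "r \<ge> 133"
  shows "1 + L * (101 / 200 * r + 1) + (1 - r / 2) * (u - 2) + 2 \<le> - r * (u / 50)"
proof -
  \<comment> \<open>Naming the products makes the claim linear. Since \<open>L < u / 41\<close>,
    \<open>133 * u <= x\<close> and \<open>41 * r <= x\<close>, everything besides
    \<open>- x / 2\<close> adds up to less than \<open>x / 20\<close>, well within the room left by
    \<open>- x / 50\<close>.\<close>
  define x y where "x = r * u" and "y = L * r"
  have "L * (101 / 200 * r + 1) \<le> u / 41 * (101 / 200 * r + 1)"
    using assms by (intro mult_right_mono) auto
  then have a: "101 / 200 * y + L \<le> (101 / 200 * x + u) / 41"
    by (simp add: x_def y_def field_simps)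
  have u: "u > 41" using assms by linarith
  have b: "133 * u \<le> x" "41 * r \<le> x"
    using assms u mult_right_mono[of 133 r u] mult_left_mono[of 41 u r]
    by (simp_all add: x_def mult.commute)
  have "1 + L * (101 / 200 * r + 1) + (1 - r / 2) * (u - 2) + 2
      = 1 + (101 / 200 * y + L) + (u - 2 - x / 2 + r) + 2"
    by (simp add: x_def y_def field_simps)
  also have "\<dots> \<le> - x / 50" using a b u by (simp add: field_simps)
  finally show ?thesis by (simp add: x_def)
qed

text \<open>K is \<open>\<rho> powr (-1/2)\<close> rounded up. This is small enough for
  \<open>n * K * \<rho>\<close> to be tiny, as n is at most \<open>\<rho> powr (-1/200)\<close>, and
  large enough for the Chernoff factor to be a power of \<open>\<rho>\<close> with exponent of order
  u. The exponent 101/200 below is 1/2 + 1/200.\<close>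

lemma ghost_sample_size:
  fixes \<rho> :: real
  assumes n: "n \<ge> (2::nat)" and \<rho>: "0 < \<rho>" "\<rho> \<le> real n powr (-200)"
  obtains K :: nat where "K \<ge> 3" "real n * real K * \<rho> \<le> 1 / 2"
    "\<And>L u. L \<ge> 1 \<Longrightarrow> u > 41 * L \<Longrightarrow>
      2 * ((real n * real K) powr L * ((exp 1 / K) powr (u - 2) * exp 2)) \<le> \<rho> powr (u / 50)"
proof -
  define r where "r = - ln \<rho>"
  define K where "K = nat \<lceil>exp (r / 2)\<rceil>"
  have \<rho>r: "\<rho> = exp (- r)" using \<rho> by (simp add: r_def)
  have "ln \<rho> \<le> ln (real n powr (-200))" using \<rho> by (intro ln_mono) auto
  then have n_le: "ln n \<le> r / 200" using n by (simp add: r_def ln_powr)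
  have "ln 2 \<le> ln (real n)" using n by (intro ln_mono) auto
  then have "2 / 3 \<le> ln (real n)" using ln2_ge_two_thirds by linarith
  \<comment> \<open>From \<open>n >= 2\<close>: r is at least 200 times 2/3.\<close>
  then have r: "r \<ge> 133" using n_le by linarith
  have n_exp: "real n \<le> exp (r / 200)" using n n_le exp_le_cancel_iff[of "ln (real n)" "r / 200"] by simp
  have K1: "exp (r / 2) \<le> K" by (simp add: K_def real_nat_ceiling_ge)
  \<comment> \<open>Rounding up costs at most a factor 2, estimated by \<open>exp 1\<close> to stay
    with exponentials.\<close>
  have "real K \<le> exp (r / 2) + 1" unfolding K_def by (simp add: of_nat_nat)
  also have "\<dots> \<le> exp (r / 2) * 2" using r by simp
  also have "\<dots> \<le> exp (r / 2) * exp 1" using exp_ge_add_one_self[of 1] by (intro mult_left_mono) auto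
  finally have K2: "K \<le> exp (r / 2 + 1)" by (simp add: exp_add)
  have K3: "K \<ge> 3" using K1 exp_ge_add_one_self[of "r / 2"] r by linarith
  have "real n * real K \<le> exp (r / 200) * exp (r / 2 + 1)" using n_exp K2 by (intro mult_mono) auto
  then have nK: "real n * real K \<le> exp (101 / 200 * r + 1)" by (simp flip: exp_add)
  then have "real n * real K * \<rho> \<le> exp (101 / 200 * r + 1) * \<rho>" using \<rho> by (intro mult_right_mono) auto
  also have "\<dots> = exp (1 - 99 / 200 * r)" by (simp add: \<rho>r flip: exp_add)
  also have "\<dots> \<le> exp (- 1)" using r by simp
  also have "\<dots> \<le> 1 / 2" using exp_ge_add_one_self[of 1] by (simp add: exp_minus field_simps)
  finally have small: "real n * real K * \<rho> \<le> 1 / 2" .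
  have "2 * ((real n * real K) powr L * ((exp 1 / K) powr (u - 2) * exp 2)) \<le> \<rho> powr (u / 50)"
    if L: "L \<ge> 1" and u: "u > 41 * L" for L u :: real
  proof -
    have "(real n * real K) powr L \<le> exp (101 / 200 * r + 1) powr L"
      using nK L by (intro powr_mono2) auto
    then have a: "(real n * real K) powr L \<le> exp (L * (101 / 200 * r + 1))"
      by (simp add: powr_def)
    have "exp 1 / K \<le> exp 1 / exp (r / 2)" using K1 K3 by (intro divide_left_mono) auto
    also have "\<dots> = exp (1 - r / 2)" by (simp add: exp_diff)
    finally have "(exp 1 / K) powr (u - 2) \<le> exp (1 - r / 2) powr (u - 2)"
      using L u by (intro powr_mono2) auto
    then have b: "(exp 1 / K) powr (u - 2) \<le> exp ((1 - r / 2) * (u - 2))"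
      by (simp add: powr_def mult.commute)
    have "2 * ((real n * real K) powr L * ((exp 1 / K) powr (u - 2) * exp 2))
        \<le> exp 1 * (exp (L * (101 / 200 * r + 1)) * (exp ((1 - r / 2) * (u - 2)) * exp 2))"
      using a b exp_ge_add_one_self[of 1] by (intro mult_mono) auto
    also have "\<dots> = exp (1 + L * (101 / 200 * r + 1) + (1 - r / 2) * (u - 2) + 2)"
      by (simp only: exp_add mult_ac)
    also have "\<dots> \<le> exp (- r * (u / 50))"
      using tail_exponent_estimate[OF L u r] by simp
    also have "\<dots> = \<rho> powr (u / 50)" by (simp add: \<rho>r powr_def)
    finally show ?thesis .
  qed
  then show ?thesis using that[of K] K3 small by blast
qed

section \<open>Transfer to the given random variables\<close>

lemma L1_dense_class_sup_tail:
  fixes F :: "('x \<Rightarrow> real) set" and \<xi> :: "nat \<Rightarrow> 'a \<Rightarrow> 'x"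
  assumes F: "countable F" and D: "D \<ge> 0" and L: "L \<ge> 1" and dense: "L1_dense_class X F D L"
    and bounded: "\<And>f x. f \<in> F \<Longrightarrow> x \<in> space X \<Longrightarrow> \<bar>f x\<bar> \<le> 1"
    and n: "n \<ge> 2" and M: "prob_space M"
    and indep: "prob_space.indep_vars M (\<lambda>_. X) \<xi> {1..n}"
    and law: "\<And>j. j \<in> {1..n} \<Longrightarrow> distr M X (\<xi> j) = \<mu>"
    and \<rho>: "0 < \<rho>" "\<rho> \<le> real n powr (-200)"
    and mean: "\<And>f. f \<in> F \<Longrightarrow> (\<integral>x. \<bar>f x\<bar> \<partial>\<mu>) \<le> \<rho>" and u: "u > 41 * L"
  shows "measure M {\<omega> \<in> space M. (SUP f\<in>F. ereal \<bar>sample_sum \<xi> n f \<omega>\<bar>) \<ge> ereal u}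
            \<le> D * \<rho> powr (u / 50)"
    (is "measure M ?S \<le> _")
proof -
  interpret M: prob_space M by fact
  let ?I = "{1..n}"
  let ?P = "\<Pi>\<^sub>M i\<in>?I. \<mu>"
  let ?E = "{x \<in> space ?P. \<exists>f\<in>F. u - 1 \<le> (\<Sum>i\<in>?I. \<bar>f (x i)\<bar>)}"
  let ?t = "\<lambda>\<omega>. \<lambda>i\<in>?I. \<xi> i \<omega>"
  have I: "1 \<in> ?I" "?I \<noteq> {}" using n by auto
  have rv: "\<xi> i \<in> measurable M X" if "i \<in> ?I" for i
    using indep that by (simp add: M.indep_vars_def2)
  have \<mu>: "prob_space \<mu>" "sets \<mu> = sets X"
    using law[OF I(1)] M.prob_space_distr[OF rv[OF I(1)]] by auto
  interpret \<mu>: prob_space \<mu> by fact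
  have meas: "f \<in> borel_measurable \<mu>" if "f \<in> F" for f
    using dense that \<mu>(2) by (simp add: L1_dense_class_def cong: measurable_cong_sets)
  have mean': "(\<integral>\<^sup>+x. ennreal \<bar>f x\<bar> \<partial>\<mu>) \<le> ennreal \<rho>" if f: "f \<in> F" for f
  proof -
    have "integrable \<mu> (\<lambda>x. \<bar>f x\<bar>)"
      using bounded[OF f] meas[OF f] sets_eq_imp_space_eq[OF \<mu>(2)]
      by (intro \<mu>.integrable_const_bound[of _ 1] AE_I2) auto
    \<comment> \<open>Integrability, which follows from boundedness, rules out the default value 0
      of the Bochner integral and identifies it with the nonnegative one.\<close>
    then show ?thesis using mean[OF f] by (simp add: nn_integral_eq_integral ennreal_leI)
  qed
  have PX: "sets (\<Pi>\<^sub>M i\<in>?I. X) = sets ?P" using \<mu>(2) by (intro sets_PiM_cong) auto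
  have t: "?t \<in> measurable M ?P"
    using rv \<mu>(2) by (intro measurable_restrict) (simp cong: measurable_cong_sets)
  \<comment> \<open>Independence and the common law make the joint law of the sample the product
    measure.\<close>
  have "distr M (\<Pi>\<^sub>M i\<in>?I. X) ?t = (\<Pi>\<^sub>M i\<in>?I. distr M X (\<xi> i))"
    using M.indep_vars_iff_distr_eq_PiM'[of ?I \<xi> "\<lambda>_. X"] I rv indep by simp
  also have "\<dots> = ?P" using law by (intro PiM_cong) auto
  also have "distr M (\<Pi>\<^sub>M i\<in>?I. X) ?t = distr M ?P ?t"
    using PX by (intro distr_cong) auto
  finally have joint: "distr M ?P ?t = ?P" .
  have E: "?E \<in> sets ?P" using measurable_class_sum_pred[OF F meas, of ?I ?I "{}" "u - 1" 1] by simp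
  have "?S \<subseteq> ?t -` ?E \<inter> space M"
  proof
    fix \<omega> assume \<omega>: "\<omega> \<in> ?S"
    \<comment> \<open>The supremum may not be attained, so one unit is given up to get an actual f.
      The net costs another unit, hence the exponent \<open>u - 2\<close> in the Chernoff
      factor.\<close>
    then have "ereal (u - 1) < (SUP f\<in>F. ereal \<bar>sample_sum \<xi> n f \<omega>\<bar>)"
      by (auto intro: less_le_trans[of _ "ereal u"])
    then obtain f where f: "f \<in> F" "u - 1 < \<bar>sample_sum \<xi> n f \<omega>\<bar>" by (auto simp: less_SUP_iff)
    have "\<bar>sample_sum \<xi> n f \<omega>\<bar> \<le> (\<Sum>i\<in>?I. \<bar>f (?t \<omega> i)\<bar>)"
      unfolding sample_sum_def using sum_abs[of "\<lambda>j. f (\<xi> j \<omega>)" ?I] by simp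
    then show "\<omega> \<in> ?t -` ?E \<inter> space M"
      using f \<omega> measurable_space[OF t] by force
  qed
  then have "measure M ?S \<le> measure M (?t -` ?E \<inter> space M)"
    using measurable_sets[OF t E] by (intro M.finite_measure_mono)
  also have "\<dots> = measure ?P ?E" using measure_distr[OF t E] unfolding joint by (rule sym)
  also have "\<dots> \<le> D * \<rho> powr (u / 50)"
  proof -
    obtain K :: nat where K: "K \<ge> 3" "real n * real K * \<rho> \<le> 1 / 2"
      "2 * ((real n * real K) powr L * ((exp 1 / K) powr (u - 2) * exp 2)) \<le> \<rho> powr (u / 50)"
      using ghost_sample_size[OF n \<rho>] L u by metis
    have "measure ?P ?E \<le> 2 * (D * (real n * real K) powr L * ((exp 1 / K) powr (u - 1 - 1) * exp 2))"
      using iid_class_sum_tail[of X F D L \<mu> \<rho> ?I K "u - 1"] dense F bounded \<mu> mean' I K \<rho>(1) by simp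
    also have "\<dots> = D * (2 * ((real n * real K) powr L * ((exp 1 / K) powr (u - 2) * exp 2)))"
      by (simp add: mult_ac)
    also have "\<dots> \<le> D * \<rho> powr (u / 50)" using K(3) D by (rule mult_left_mono)
    finally show ?thesis .
  qed
  finally show ?thesis .
qed

theorem theorem1:
  shows "\<exists>C::real. 0 < C \<and> C < 1 \<and> C = 1 / 50 \<and>
    (\<forall>(X :: 'x measure) (F :: ('x \<Rightarrow> real) set) (D :: real) (L :: real)
       (M :: 'a measure) (\<xi> :: nat \<Rightarrow> 'a \<Rightarrow> 'x) (\<mu> :: 'x measure) (n :: nat) (\<rho> :: real).
       countable F \<and> D \<ge> 1 \<and> L \<ge> 1 \<and> L1_dense_class X F D L \<and>
       (\<forall>f\<in>F. \<forall>x\<in>space X. \<bar>f x\<bar> \<le> 1) \<and>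
       n \<ge> 2 \<and> prob_space M \<and>
       prob_space.indep_vars M (\<lambda>_. X) \<xi> {1..n} \<and>
       (\<forall>j\<in>{1..n}. distr M X (\<xi> j) = \<mu>) \<and>
       0 < \<rho> \<and> \<rho> \<le> real n powr (-200) \<and>
       (\<forall>f\<in>F. (\<integral>x. \<bar>f x\<bar> \<partial>\<mu>) \<le> \<rho>) \<longrightarrow>
       (\<forall>u::real. u > 41 * L \<longrightarrow>
          measure M {\<omega> \<in> space M. (SUP f\<in>F. ereal \<bar>sample_sum \<xi> n f \<omega>\<bar>) \<ge> ereal u}
            \<le> D * \<rho> powr (C * u)))"
proof (intro exI[of _ "1 / 50"] conjI allI impI; (elim conjE)?)
  fix X :: "'x measure" and F D L and M :: "'a measure" and \<xi> \<mu> n \<rho> u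
  assume "countable F" "(1::real) \<le> D" "1 \<le> L" "L1_dense_class X F D L"
    "\<forall>f\<in>F. \<forall>x\<in>space X. \<bar>f x\<bar> \<le> 1" "2 \<le> n" "prob_space M"
    "prob_space.indep_vars M (\<lambda>_. X) \<xi> {1..n}" "\<forall>j\<in>{1..n}. distr M X (\<xi> j) = \<mu>"
    "0 < \<rho>" "\<rho> \<le> real n powr (-200)" "\<forall>f\<in>F. (\<integral>x. \<bar>f x\<bar> \<partial>\<mu>) \<le> \<rho>" "u > 41 * L"
  then show "measure M {\<omega> \<in> space M. (SUP f\<in>F. ereal \<bar>sample_sum \<xi> n f \<omega>\<bar>) \<ge> ereal u}
      \<le> D * \<rho> powr (1 / 50 * u)"
    using L1_dense_class_sup_tail[of F D L X n M \<xi> \<mu> \<rho> u] by simp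
qed simp_all

end
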